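(* $\mathrm{DIS}\equiv_{\mathrm{sW}}\mathrm{NRNG}$, i.e., the discontinuity problem is strongly Weihrauch equivalent to the range non-equality problem.
   Context: A represented space is a set $X$ with a partial surjective map $\delta_X:\subseteq\mathbb N^{\mathbb N}\to X$. A problem is a partial multi-valued function $f:\subseteq X\rightrightarrows Y$ between represented spaces that has a realizer; a realizer of $f$ is a function $F:\subseteq\mathbb N^{\mathbb N}\to\mathbb N^{\mathbb N}$ with $\delta_YF(p)\in f\delta_X(p)$ for all $p\in\mathrm{dom}(f\delta_X)$. For problems $f,g$: $f\leq_{\mathrm{sW}}g$ if there are computable $H,K:\subseteq\mathbb N^{\mathbb N}\to\mathbb N^{\mathbb N}$ such that $HGK$ is a realizer of $f$ whenever $G$ is a realizer of $g$; $f\equiv_{\mathrm{sW}}g$ means $f\leq_{\mathrm{sW}}g$ and $g\leq_{\mathrm{sW}}f$. $\mathbb N^{\mathbb N}$ and $2^{\mathbb N}=\{0,1\}^{\mathbb N}$ are represented by (restrictions of) the identity; subsets $A\subseteq\mathbb N$ are identified with their characteristic functions in $2^{\mathbb N}$. $p-1\in\mathbb N^{\mathbb N}\cup\mathbb N^*$ denotes the finite or infinite concatenation of $p(0)-1,p(1)-1,\dots$, where $0-1$ is the empty word; thus $\mathrm{range}(p-1)=\{k:(\exists n)\ p(n)=k+1\}$. $\mathrm{NRNG}:\mathbb N^{\mathbb N}\rightrightarrows2^{\mathbb N}$, $p\mapsto\{A\in2^{\mathbb N}:A\neq\mathrm{range}(p-1)\}$. $\mathrm{DIS}:\mathbb N^{\mathbb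 N}\rightrightarrows\mathbb N^{\mathbb N}$, $p\mapsto\{q:\mathrm U(p)\neq q\}$ (every $q$ is a solution if $\mathrm U(p)$ is undefined), where $\mathrm U:\subseteq\mathbb N^{\mathbb N}\to\mathbb N^{\mathbb N}$ is $\mathrm U\langle\langle i,r\rangle,p\rangle:=\varphi_i^{\langle r,p\rangle}$ if this function is total and undefined otherwise. Here $\varphi^p$ is a standard Gödel numbering of the partial functions $\varphi_i^p:\subseteq\mathbb N\to\mathbb N$ computable relative to $p$; $\langle p,q\rangle(2n)=p(n)$, $\langle p,q\rangle(2n+1)=q(n)$ for $p,q\in\mathbb N^{\mathbb N}$; and $\langle i,r\rangle:=ir$ (concatenation) for $i\in\mathbb N$, $r\in\mathbb N^{\mathbb N}$. *)

theory Defs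
  imports "HOL-Library.Nat_Bijection" "HOL-Library.Indicator_Function"
begin

type_synonym baire = "nat \<Rightarrow> nat"

section \<open>Computability relative to an oracle\<close>

text \<open>Programs for the partial recursive functions relative to an oracle \<open>p\<close>, in Kleene's
  style (primitive recursion and minimization). All functions are unary; several arguments are
  passed through the bijection \<^const>\<open>prod_encode\<close>, so the identity is
  \<open>CPair CFst CSnd\<close>.\<close>

datatype code =
    CZero | CSucc | CFst | CSnd | COracle
  | CPair code code | CComp code code | CPrec code code | CMu code

primrec eval :: "baire \<Rightarrow> code \<Rightarrow> nat \<rightharpoonup> nat" where
  "eval p CZero = (\<lambda>x. Some 0)"
| "eval p CSucc = (\<lambda>x. Some (Suc x))"
| "eval p CFst = (\<lambda>x. Some (fst (prod_decode x)))"
| "eval p CSnd = (\<lambda>x. Some (snd (prod_decode x)))"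
| "eval p COracle = (\<lambda>x. Some (p x))"
| "eval p (CPair f g) = (\<lambda>x. case (eval p f x, eval p g x) of
       (Some a, Some b) \<Rightarrow> Some (prod_encode (a, b)) | _ \<Rightarrow> None)"
| "eval p (CComp f g) = eval p f \<circ>\<^sub>m eval p g"
| "eval p (CPrec f g) = (\<lambda>x. case prod_decode x of (a, m) \<Rightarrow>
       rec_nat (eval p f a)
         (\<lambda>k r. Option.bind r (\<lambda>y. eval p g (prod_encode (a, prod_encode (k, y))))) m)"
| "eval p (CMu f) = (\<lambda>x.
       if \<exists>m. eval p f (prod_encode (x, m)) = Some 0 \<and>
              (\<forall>k<m. eval p f (prod_encode (x, k)) \<noteq> None)
       then Some (LEAST m. eval p f (prod_encode (x, m)) = Some 0)
       else None)"

lemma snd_prod_decode_less: "0 < fst (prod_decode i) \<Longrightarrow> snd (prod_decode i) < i"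
proof -
  assume a: "0 < fst (prod_decode i)"
  obtain t x where tx: "prod_decode i = (t, x)" by force
  then have i: "i = prod_encode (t, x)" by (metis prod_decode_inverse)
  have "n \<le> triangle n" for n by (induction n) auto
  then have "t + x \<le> triangle (t + x)" .
  with a tx i show ?thesis by (simp add: prod_encode_def)
qed

lemma fst_prod_decode_le: "fst (prod_decode i) \<le> i"
  and snd_prod_decode_le: "snd (prod_decode i) \<le> i"
  by (metis le_prod_encode_1 prod.collapse prod_decode_inverse,
      metis le_prod_encode_2 prod.collapse prod_decode_inverse)

text \<open>An index is a pair of a tag (the outermost constructor) and a payload (the indices of the
  subprograms).\<close>

function decode :: "nat \<Rightarrow> code" where
  "decode i = (let t = fst (prod_decode i); x = snd (prod_decode i);
                   a = fst (prod_decode x); b = snd (prod_decode x) in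
     if t = 0 then CZero
     else if t = 1 then CSucc
     else if t = 2 then CFst
     else if t = 3 then CSnd
     else if t = 4 then COracle
     else if t = 5 then CPair (decode a) (decode b)
     else if t = 6 then CComp (decode a) (decode b)
     else if t = 7 then CPrec (decode a) (decode b)
     else CMu (decode x))"
  by auto
termination
  by (relation "measure id")
    (auto intro!: snd_prod_decode_less
      intro: le_less_trans[OF fst_prod_decode_le] le_less_trans[OF snd_prod_decode_le])

declare decode.simps [simp del]

lemma surj_decode: "surj decode"
proof -
  have "\<exists>i. decode i = c" for c
  proof (induction c)
    case CZero show ?case by (rule exI[of _ "prod_encode (0, 0)"]) (subst decode.simps, simp)
  next
    case CSucc show ?case by (rule exI[of _ "prod_encode (1, 0)"]) (subst decode.simps, simp)
  next
    case CFst show ?case by (rule exI[of _ "prod_encode (2, 0)"]) (subst decode.simps, simp)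
  next
    case CSnd show ?case by (rule exI[of _ "prod_encode (3, 0)"]) (subst decode.simps, simp)
  next
    case COracle show ?case by (rule exI[of _ "prod_encode (4, 0)"]) (subst decode.simps, simp)
  next
    case (CPair f g)
    then obtain a b where "decode a = f" "decode b = g" by blast
    then show ?case
      by (intro exI[of _ "prod_encode (5, prod_encode (a, b))"]) (subst decode.simps, simp)
  next
    case (CComp f g)
    then obtain a b where "decode a = f" "decode b = g" by blast
    then show ?case
      by (intro exI[of _ "prod_encode (6, prod_encode (a, b))"]) (subst decode.simps, simp)
  next
    case (CPrec f g)
    then obtain a b where "decode a = f" "decode b = g" by blast
    then show ?case
      by (intro exI[of _ "prod_encode (7, prod_encode (a, b))"]) (subst decode.simps, simp)
  next
    case (CMu f)
    then obtain a where "decode a = f" by blast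
    then show ?case
      by (intro exI[of _ "prod_encode (8, a)"]) (subst decode.simps, simp)
  qed
  then show ?thesis by (metis surjI)
qed

text \<open>A numbering \<open>\<phi>\<close> is written with the index first: \<open>\<phi> i p n\<close> is
  \<open>\<phi>\<close> with index \<open>i\<close> and oracle \<open>p\<close> at \<open>n\<close>.\<close>

type_synonym numbering = "nat \<Rightarrow> baire \<Rightarrow> nat \<rightharpoonup> nat"

definition kleene_numbering :: numbering where
  "kleene_numbering i p = eval p (decode i)"

definition computable_nat :: "(nat \<Rightarrow> nat) \<Rightarrow> bool" where
  "computable_nat s \<longleftrightarrow> (\<exists>c. \<forall>p n. eval p c n = Some (s n))"

text \<open>Acceptable (standard) numberings in the sense of Rogers: those intertranslatable with
  \<^const>\<open>kleene_numbering\<close> by total computable functions, uniformly in the oracle.\<close>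

definition standard_numbering :: "numbering \<Rightarrow> bool" where
  "standard_numbering \<phi> \<longleftrightarrow>
     (\<exists>s. computable_nat s \<and> (\<forall>i. \<phi> i = kleene_numbering (s i))) \<and>
     (\<exists>t. computable_nat t \<and> (\<forall>i. kleene_numbering i = \<phi> (t i)))"

lemma standard_kleene_numbering: "standard_numbering kleene_numbering"
proof -
  have "eval p (CPair CFst CSnd) n = Some (id n)" for p n
    by simp
  then have "computable_nat id"
    unfolding computable_nat_def by blast
  then show ?thesis
    unfolding standard_numbering_def by (metis id_apply)
qed

text \<open>As usual, a program for \<open>F\<close> only has to be correct on the domain of \<open>F\<close>.\<close>

definition computable :: "(baire \<rightharpoonup> baire) \<Rightarrow> bool" where
  "computable F \<longleftrightarrow>
     (\<exists>c. \<forall>p q. F p = Some q \<longrightarrow> (\<forall>n. eval p c n = Some (q n)))"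

section \<open>Represented spaces, problems and strong Weihrauch reducibility\<close>

text \<open>A represented space is given by its representation \<open>\<delta>\<close>; the underlying set is
  \<open>ran \<delta>\<close>, so that \<open>\<delta>\<close> is surjective.\<close>

type_synonym 'a representation = "baire \<rightharpoonup> 'a"

text \<open>The domain of the multi-valued function \<open>sols f\<close> is \<open>{x. sols f x \<noteq> {}}\<close>.\<close>

record ('a, 'b) multifun =
  source :: "'a representation"
  target :: "'b representation"
  sols :: "'a \<Rightarrow> 'b set"

definition realizer :: "(baire \<rightharpoonup> baire) \<Rightarrow> ('a, 'b) multifun \<Rightarrow> bool" where
  "realizer F f \<longleftrightarrow>
     (\<forall>p x. source f p = Some x \<and> sols f x \<noteq> {} \<longrightarrow>
        (\<exists>q y. F p = Some q \<and> target f q = Some y \<and> y \<in> sols f x))"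

definition is_problem :: "('a, 'b) multifun \<Rightarrow> bool" where
  "is_problem f \<longleftrightarrow>
     {x. sols f x \<noteq> {}} \<subseteq> ran (source f) \<and> (\<forall>x. sols f x \<subseteq> ran (target f)) \<and>
     (\<exists>F. realizer F f)"

definition sW_reducible ::
    "('a, 'b) multifun \<Rightarrow> ('c, 'd) multifun \<Rightarrow> bool" (infix "\<le>\<^sub>s\<^sub>W" 50) where
  "f \<le>\<^sub>s\<^sub>W g \<longleftrightarrow>
     is_problem f \<and> is_problem g \<and>
     (\<exists>H K. computable H \<and> computable K \<and>
        (\<forall>G. realizer G g \<longrightarrow> realizer (H \<circ>\<^sub>m G \<circ>\<^sub>m K) f))"

definition sW_equivalent ::
    "('a, 'b) multifun \<Rightarrow> ('c, 'd) multifun \<Rightarrow> bool" (infix "\<equiv>\<^sub>s\<^sub>W" 50) where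
  "f \<equiv>\<^sub>s\<^sub>W g \<longleftrightarrow> f \<le>\<^sub>s\<^sub>W g \<and> g \<le>\<^sub>s\<^sub>W f"

section \<open>The problems NRNG and DIS\<close>

text \<open>Subsets of the natural numbers are represented by their characteristic functions, so
  Cantor space is a subset of Baire space.\<close>

definition cantor :: "baire set" where
  "cantor = {p. \<forall>n. p n \<in> {0, 1}}"

text \<open>The range of the word \<open>p - 1\<close>, in which every \<open>0\<close> of \<open>p\<close> is skipped.\<close>

definition range_minus_one :: "baire \<Rightarrow> nat set" where
  "range_minus_one p = {k. \<exists>n. p n = k + 1}"

definition NRNG :: "(baire, baire) multifun" where
  "NRNG = \<lparr>source = Some, target = Some |` cantor,
           sols = (\<lambda>p. {A \<in> cantor. A \<noteq> indicator (range_minus_one p)})\<rparr>"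

definition bpair :: "baire \<Rightarrow> baire \<Rightarrow> baire" where
  "bpair p q = (\<lambda>n. if even n then p (n div 2) else q (n div 2))"

definition bfst :: "baire \<Rightarrow> baire" where
  "bfst x = (\<lambda>n. x (2 * n))"

definition bsnd :: "baire \<Rightarrow> baire" where
  "bsnd x = (\<lambda>n. x (2 * n + 1))"

definition bcons :: "nat \<Rightarrow> baire \<Rightarrow> baire" where
  "bcons i r = case_nat i r"

definition U :: "numbering \<Rightarrow> baire \<rightharpoonup> baire" where
  "U \<phi> x =
     (let i = bfst x 0; r = (\<lambda>n. bfst x (Suc n)); f = \<phi> i (bpair r (bsnd x))
      in if \<forall>n. f n \<noteq> None then Some (\<lambda>n. the (f n)) else None)"

lemma U_bpair:
  "U \<phi> (bpair (bcons i r) p) =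
     (if \<forall>n. \<phi> i (bpair r p) n \<noteq> None
      then Some (\<lambda>n. the (\<phi> i (bpair r p) n)) else None)"
proof -
  have "bfst (bpair (bcons i r) p) = bcons i r" "bsnd (bpair (bcons i r) p) = p"
    by (auto simp: bfst_def bsnd_def bpair_def)
  then show ?thesis by (simp add: U_def bcons_def Let_def)
qed

lemma is_problem_NRNG: "is_problem NRNG"
proof -
  define A :: "baire \<Rightarrow> baire" where "A p = indicator (- range_minus_one p)" for p
  have A: "A p \<in> cantor" "A p \<noteq> indicator (range_minus_one p)" for p
    by (auto simp: A_def cantor_def indicator_def fun_eq_iff)
  have "realizer (Some \<circ> A) NRNG"
    using A by (simp add: realizer_def NRNG_def)
  moreover have "{x. sols NRNG x \<noteq> {}} \<subseteq> ran (source NRNG)"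
    by (auto simp: NRNG_def ran_def)
  moreover have "\<forall>x. sols NRNG x \<subseteq> ran (target NRNG)"
    by (auto simp: NRNG_def ran_def restrict_map_def)
  ultimately show ?thesis
    unfolding is_problem_def by blast
qed

definition DIS :: "numbering \<Rightarrow> (baire, baire) multifun" where
  "DIS \<phi> = \<lparr>source = Some, target = Some, sols = (\<lambda>p. {q. U \<phi> p \<noteq> Some q})\<rparr>"

lemma is_problem_DIS: "is_problem (DIS \<phi>)"
proof -
  have "\<exists>q. U \<phi> p \<noteq> Some q" for p
  proof -
    have "(\<lambda>_. 0 :: nat) \<noteq> (\<lambda>_ :: nat. 1)"
      by (simp add: fun_eq_iff)
    then show ?thesis
      by (metis option.inject)
  qed
  then obtain Q where "U \<phi> p \<noteq> Some (Q p)" for p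
    by metis
  then have "realizer (Some \<circ> Q) (DIS \<phi>)"
    by (simp add: realizer_def DIS_def)
  then show ?thesis
    by (auto simp: is_problem_def DIS_def ran_def)
qed

end

(*
  DIS is reduced to NRNG with the identity as outer reduction: an instance x is mapped to an
  enumeration of {k. U x k = 1}. If U x is total and equal to a characteristic function A, then this
  set is A, so any A different from the enumerated set differs from U x. The enumeration is
  computable because programs can be run step by step on a stack machine, which is itself a
  primitive recursive function. The machine only has to be correct on terminating computations,
  since nothing is required of the enumeration when U x is undefined.

  NRNG is reduced to DIS by mapping a solution q to (the characteristic function of) its graph. From
  any enumeration of the graph of q one computes q, by searching for a pair with the given first
  component; so if an index of this search is used as the instance of DIS, a q different from the
  result of the search has a graph different from the enumerated set.
*)

theory Submission
  imports Defs
begin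

section \<open>Total functionals computed by a program\<close>

text \<open>One program serves all oracles. The inner and outer reductions in both directions are
  total on Baire space, so closure properties can be stated without conditions on domains.\<close>

definition total_computable :: "(baire \<Rightarrow> nat \<Rightarrow> nat) \<Rightarrow> bool" where
  "total_computable F \<longleftrightarrow> (\<exists>c. \<forall>p n. eval p c n = Some (F p n))"

lemma total_computableI: "(\<And>p n. eval p c n = Some (F p n)) \<Longrightarrow> total_computable F"
  unfolding total_computable_def by blast

lemma computable_if_total_computable: "total_computable F \<Longrightarrow> computable (\<lambda>p. Some (F p))"
  unfolding total_computable_def computable_def by auto

abbreviation pair :: "nat \<Rightarrow> nat \<Rightarrow> nat" where
  "pair a b \<equiv> prod_encode (a, b)"

abbreviation pfst :: "nat \<Rightarrow> nat" where
  "pfst n \<equiv> fst (prod_decode n)"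

abbreviation psnd :: "nat \<Rightarrow> nat" where
  "psnd n \<equiv> snd (prod_decode n)"

named_theorems total_computable_intros

lemma total_computable_id [total_computable_intros]: "total_computable (\<lambda>p n. n)"
  by (rule total_computableI[of "CPair CFst CSnd"]) simp

lemma total_computable_const [total_computable_intros]: "total_computable (\<lambda>p n. k)"
proof (induction k)
  case 0
  show ?case by (rule total_computableI[of CZero]) simp
next
  case (Suc k)
  then obtain c where "eval p c n = Some k" for p n
    unfolding total_computable_def by blast
  then show ?case by (intro total_computableI[of "CComp CSucc c"]) (simp add: map_comp_def)
qed

lemma total_computable_comp:
  assumes "total_computable F" "total_computable a"
  shows "total_computable (\<lambda>p n. F p (a p n))"
proof -
  obtain c where c: "eval p c n = Some (F p n)" for p n
    using assms(1) unfolding total_computable_def by blast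
  obtain d where d: "eval p d n = Some (a p n)" for p n
    using assms(2) unfolding total_computable_def by blast
  show ?thesis
    by (rule total_computableI[of "CComp c d"]) (simp add: c d map_comp_def)
qed

lemma total_computable_Suc [total_computable_intros]:
  "total_computable a \<Longrightarrow> total_computable (\<lambda>p n. Suc (a p n))"
  by (rule total_computable_comp[of "\<lambda>p n. Suc n"]) (auto intro: total_computableI[of CSucc])

lemma total_computable_pfst [total_computable_intros]:
  "total_computable a \<Longrightarrow> total_computable (\<lambda>p n. pfst (a p n))"
  by (rule total_computable_comp[of "\<lambda>p n. pfst n"]) (auto intro: total_computableI[of CFst])

lemma total_computable_psnd [total_computable_intros]:
  "total_computable a \<Longrightarrow> total_computable (\<lambda>p n. psnd (a p n))"
  by (rule total_computable_comp[of "\<lambda>p n. psnd n"]) (auto intro: total_computableI[of CSnd])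

lemma total_computable_oracle [total_computable_intros]:
  "total_computable a \<Longrightarrow> total_computable (\<lambda>p n. p (a p n))"
  by (rule total_computable_comp[of "\<lambda>p n. p n"]) (auto intro: total_computableI[of COracle])

lemma total_computable_pair [total_computable_intros]:
  assumes "total_computable a" "total_computable b"
  shows "total_computable (\<lambda>p n. pair (a p n) (b p n))"
proof -
  obtain c where c: "eval p c n = Some (a p n)" for p n
    using assms(1) unfolding total_computable_def by blast
  obtain d where d: "eval p d n = Some (b p n)" for p n
    using assms(2) unfolding total_computable_def by blast
  show ?thesis
    by (rule total_computableI[of "CPair c d"]) (simp add: c d)
qed

text \<open>The step \<open>h\<close> may depend on the input, which \<open>CPrec\<close> passes on
  as its parameter; the count is supplied afterwards by composing with
  \<open>pair n (m p n)\<close>.\<close>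

lemma total_computable_rec_nat:
  assumes "total_computable a" "total_computable m"
    and "total_computable (\<lambda>p z. h p (pfst z) (pfst (psnd z)) (psnd (psnd z)))"
  shows "total_computable (\<lambda>p n. rec_nat (a p n) (h p n) (m p n))"
proof -
  obtain c where c: "eval p c n = Some (a p n)" for p n
    using assms(1) unfolding total_computable_def by blast
  obtain d where d: "eval p d z = Some (h p (pfst z) (pfst (psnd z)) (psnd (psnd z)))" for p z
    using assms(3) unfolding total_computable_def by blast
  have rec: "rec_nat (eval p c n)
      (\<lambda>k r. Option.bind r (\<lambda>y. eval p d (pair n (pair k y)))) k = Some (rec_nat (a p n) (h p n) k)"
    for p n k
    by (induction k) (simp_all add: c d)
  have "total_computable (\<lambda>p z. rec_nat (a p (pfst z)) (h p (pfst z)) (psnd z))"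
    by (rule total_computableI[of "CPrec c d"]) (simp add: rec split: prod.split)
  from total_computable_comp[OF this total_computable_pair[OF total_computable_id assms(2)]]
  show ?thesis by simp
qed

text \<open>A case distinction is a recursion whose step ignores the counter and the previous
  value.\<close>

lemma total_computable_if_zero:
  assumes "total_computable a" "total_computable u" "total_computable v"
  shows "total_computable (\<lambda>p n. if a p n = 0 then u p n else v p n)"
proof -
  have "total_computable (\<lambda>p n. rec_nat (u p n) (\<lambda>_ _. v p n) (a p n))"
    by (intro total_computable_rec_nat assms(1,2) total_computable_comp[OF assms(3)]
        total_computable_intros)
  moreover have "rec_nat b (\<lambda>_ _. c) k = (if k = 0 then b else c)" for b c k :: nat
    by (cases k) auto
  ultimately show ?thesis by simp
qed

lemma total_computable_diff [total_computable_intros]: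
  assumes "total_computable a" "total_computable b"
  shows "total_computable (\<lambda>p n. a p n - b p n)"
proof -
  have "total_computable (\<lambda>p n. rec_nat 0 (\<lambda>k _. k) n)"
    by (intro total_computable_rec_nat total_computable_intros)
  moreover have "rec_nat 0 (\<lambda>k _. k) k = k - 1" for k :: nat
    by (cases k) auto
  ultimately have pred: "total_computable (\<lambda>p n. n - 1)" by simp
  have "total_computable (\<lambda>p n. rec_nat (a p n) (\<lambda>_ r. r - 1) (b p n))"
    by (intro total_computable_rec_nat assms total_computable_comp[OF pred]
        total_computable_intros)
  moreover have "rec_nat i (\<lambda>_ r. r - 1) k = i - k" for i k :: nat
    by (induction k) auto
  ultimately show ?thesis by simp
qed

text \<open>Numbers are equal iff both truncated differences vanish.\<close>

lemma total_computable_if_eq [total_computable_intros]: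
  assumes "total_computable a" "total_computable b" "total_computable u" "total_computable v"
  shows "total_computable (\<lambda>p n. if a p n = b p n then u p n else v p n)"
proof -
  have "total_computable (\<lambda>p n. if a p n - b p n = 0 then
      if b p n - a p n = 0 then u p n else v p n else v p n)"
    by (intro total_computable_if_zero total_computable_diff assms)
  moreover have "(if i - j = 0 then if j - i = 0 then k else l else l) = (if i = j then k else l)"
    for i j k l :: nat
    by auto
  ultimately show ?thesis by (simp only:)
qed

lemma total_computable_if_even [total_computable_intros]:
  assumes "total_computable a" "total_computable u" "total_computable v"
  shows "total_computable (\<lambda>p n. if even (a p n) then u p n else v p n)"
proof -
  have "total_computable (\<lambda>p n. rec_nat 0 (\<lambda>_ r. 1 - r) (a p n))"
    by (intro total_computable_rec_nat assms(1) total_computable_intros)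
  moreover have "rec_nat 0 (\<lambda>_ r. 1 - r) k = k mod 2" for k :: nat
    by (induction k) (auto simp: mod_Suc)
  ultimately have "total_computable (\<lambda>p n. a p n mod 2)" by simp
  from total_computable_if_zero[OF this assms(2,3)]
  show ?thesis by (simp add: even_iff_mod_2_eq_zero)
qed

lemma total_computable_half [total_computable_intros]:
  assumes "total_computable a"
  shows "total_computable (\<lambda>p n. a p n div 2)"
proof -
  have "total_computable (\<lambda>p n. rec_nat 0 (\<lambda>k r. if even k then r else Suc r) (a p n))"
    by (intro total_computable_rec_nat assms total_computable_intros)
  moreover have "rec_nat 0 (\<lambda>k r. if even k then r else Suc r) k = k div 2" for k :: nat
    by (induction k) auto
  ultimately show ?thesis by simp
qed

lemma total_computable_double [total_computable_intros]:
  assumes "total_computable a"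
  shows "total_computable (\<lambda>p n. 2 * a p n)"
proof -
  have "total_computable (\<lambda>p n. rec_nat 0 (\<lambda>_ r. Suc (Suc r)) (a p n))"
    by (intro total_computable_rec_nat assms total_computable_intros)
  moreover have "rec_nat 0 (\<lambda>_ r. Suc (Suc r)) k = 2 * k" for k :: nat
    by (induction k) auto
  ultimately show ?thesis by simp
qed

lemma total_computable_funpow:
  assumes "total_computable a" "total_computable m" "total_computable F"
  shows "total_computable (\<lambda>p n. (F p ^^ m p n) (a p n))"
proof -
  have "total_computable (\<lambda>p n. rec_nat (a p n) (\<lambda>_ r. F p r) (m p n))"
    by (intro total_computable_rec_nat assms(1,2) total_computable_comp[OF assms(3)]
        total_computable_intros)
  moreover have "rec_nat i (\<lambda>_ r. f r) k = (f ^^ k) i" for i k :: nat and f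
    by (induction k) auto
  ultimately show ?thesis by simp
qed

section \<open>A stack machine running programs\<close>

text \<open>A state either runs the program with index \<open>i\<close> on input \<open>x\<close> or returns the value \<open>y\<close>,
  in both cases to the stack \<open>k\<close>. The empty stack is \<open>0\<close>.\<close>

definition run :: "nat \<Rightarrow> nat \<Rightarrow> nat \<Rightarrow> nat" where
  "run i x k = pair 0 (pair i (pair x k))"

definition ret :: "nat \<Rightarrow> nat \<Rightarrow> nat" where
  "ret y k = pair 1 (pair y k)"

text \<open>A tag, data and the rest of the stack. \<open>Suc\<close> keeps a nonempty stack apart
  from the empty one.\<close>

definition frame :: "nat \<Rightarrow> nat \<Rightarrow> nat \<Rightarrow> nat" where
  "frame t d k = Suc (pair t (pair d k))"

lemma total_computable_run [total_computable_intros]: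
  "total_computable a \<Longrightarrow> total_computable b \<Longrightarrow> total_computable c \<Longrightarrow>
    total_computable (\<lambda>p n. run (a p n) (b p n) (c p n))"
  unfolding run_def by (intro total_computable_intros)

lemma total_computable_ret [total_computable_intros]:
  "total_computable a \<Longrightarrow> total_computable b \<Longrightarrow> total_computable (\<lambda>p n. ret (a p n) (b p n))"
  unfolding ret_def by (intro total_computable_intros)

lemma total_computable_frame [total_computable_intros]:
  "total_computable a \<Longrightarrow> total_computable b \<Longrightarrow> total_computable c \<Longrightarrow>
    total_computable (\<lambda>p n. frame (a p n) (b p n) (c p n))"
  unfolding frame_def by (intro total_computable_intros)

text \<open>The tag of an index is as in \<^const>\<open>decode\<close>. The frames are: \<open>0\<close> and \<open>4\<close> for a pair
  whose first, respectively second, component is being computed, \<open>1\<close> for a composition, \<open>2\<close> for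
  a primitive recursion and \<open>3\<close> for a minimization.\<close>

definition run_step :: "baire \<Rightarrow> nat \<Rightarrow> nat \<Rightarrow> nat \<Rightarrow> nat" where
  "run_step q i x k =
     (let t = pfst i; u = psnd i; a = pfst u; b = psnd u in
      if t = 0 then ret 0 k
      else if t = 1 then ret (Suc x) k
      else if t = 2 then ret (pfst x) k
      else if t = 3 then ret (psnd x) k
      else if t = 4 then ret (q x) k
      else if t = 5 then run a x (frame 0 (pair b x) k)
      else if t = 6 then run b x (frame 1 a k)
      else if t = 7 then run a (pfst x) (frame 2 (pair b (pair (pfst x) (pair 0 (psnd x)))) k)
      else run u (pair x 0) (frame 3 (pair u (pair x 0)) k))"

text \<open>The data \<open>d\<close> of a frame: for tag 0, the index of the second component and
  the input; for 1, the index of the outer program; for 2, the index of the recursion step, the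
  parameter, the counter and the bound; for 3, the index, the input and the current candidate; for
  4, the value of the first component.\<close>

definition ret_step :: "nat \<Rightarrow> nat \<Rightarrow> nat \<Rightarrow> nat \<Rightarrow> nat" where
  "ret_step y t d k =
     (let a = pfst d; x = pfst (psnd d); j = psnd (psnd d) in
      if t = 0 then run a (psnd d) (frame 4 y k)
      else if t = 1 then run d y k
      else if t = 2 then
        if pfst j = psnd j then ret y k
        else run a (pair x (pair (pfst j) y))
          (frame 2 (pair a (pair x (pair (Suc (pfst j)) (psnd j)))) k)
      else if t = 3 then
        if y = 0 then ret j k
        else run a (pair x (Suc j)) (frame 3 (pair a (pair x (Suc j))) k)
      else ret (pair d y) k)"

text \<open>In a running state \<open>y\<close> is the index and \<open>k\<close> pairs input and
  stack; in a returning state they are value and stack, and \<open>k - 1\<close> undoes the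
  \<open>Suc\<close> of \<open>frame\<close>.\<close>

definition step :: "baire \<Rightarrow> nat \<Rightarrow> nat" where
  "step q s =
     (let y = pfst (psnd s); k = psnd (psnd s); f = k - 1 in
      if pfst s = 0 then run_step q y (pfst k) (psnd k)
      else if k = 0 then s
      else ret_step y (pfst f) (pfst (psnd f)) (psnd (psnd f)))"

lemma step_run [simp]: "step q (run i x k) = run_step q i x k"
  by (simp add: step_def run_def)

lemma step_ret_empty [simp]: "step q (ret y 0) = ret y 0"
  by (simp add: step_def ret_def)

lemma step_ret_frame [simp]: "step q (ret y (frame t d k)) = ret_step y t d k"
  by (simp add: step_def ret_def frame_def)

lemma total_computable_run_step [total_computable_intros]:
  assumes "total_computable q" "total_computable a" "total_computable b" "total_computable c"
  shows "total_computable (\<lambda>p n. run_step (q p) (a p n) (b p n) (c p n))"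
  unfolding run_step_def Let_def
  by (intro total_computable_intros assms total_computable_comp[OF assms(1)])

lemma total_computable_ret_step [total_computable_intros]:
  assumes "total_computable a" "total_computable b" "total_computable c" "total_computable d"
  shows "total_computable (\<lambda>p n. ret_step (a p n) (b p n) (c p n) (d p n))"
  unfolding ret_step_def Let_def by (intro total_computable_intros assms)

text \<open>The oracle of the simulated program may itself be computed from \<open>p\<close>,
  because an instance of \<open>DIS\<close> contains that oracle.\<close>

lemma total_computable_step:
  assumes "total_computable q"
  shows "total_computable (\<lambda>p. step (q p))"
  unfolding step_def Let_def by (intro total_computable_intros assms)

section \<open>Correctness of the machine on terminating computations\<close>

definition reaches :: "baire \<Rightarrow> nat \<Rightarrow> nat \<Rightarrow> bool" where
  "reaches q s t \<longleftrightarrow> (\<exists>n. (step q ^^ n) s = t)"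

lemma reaches_refl: "reaches q s s"
  unfolding reaches_def by (rule exI[of _ 0]) simp

lemma reaches_trans: "reaches q s t \<Longrightarrow> reaches q t u \<Longrightarrow> reaches q s u"
  unfolding reaches_def by (metis comp_apply funpow_add)

lemma reaches_step: "reaches q (step q s) t \<Longrightarrow> reaches q s t"
  unfolding reaches_def by (metis comp_apply funpow_Suc_right)

lemma reaches_if_step: "step q s = t \<Longrightarrow> reaches q s t"
  by (rule reaches_step) (simp add: reaches_refl)

text \<open>Reads off which branch of \<open>run_step\<close> applies. Every tag above 7 decodes to
  a minimization, hence the inequality in the last case.\<close>

lemma decode_cases:
  fixes i :: nat
  defines "t \<equiv> pfst i" and "u \<equiv> psnd i"
  shows "decode i = CZero \<Longrightarrow> t = 0" "decode i = CSucc \<Longrightarrow> t = 1" "decode i = CFst \<Longrightarrow> t = 2"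
    "decode i = CSnd \<Longrightarrow> t = 3" "decode i = COracle \<Longrightarrow> t = 4"
    "decode i = CPair f g \<Longrightarrow> t = 5 \<and> decode (pfst u) = f \<and> decode (psnd u) = g"
    "decode i = CComp f g \<Longrightarrow> t = 6 \<and> decode (pfst u) = f \<and> decode (psnd u) = g"
    "decode i = CPrec f g \<Longrightarrow> t = 7 \<and> decode (pfst u) = f \<and> decode (psnd u) = g"
    "decode i = CMu f \<Longrightarrow> t > 7 \<and> decode u = f"
  unfolding t_def u_def
  by (subst (asm) decode.simps, simp add: Let_def split: if_splits; linarith?)+

text \<open>Induction on the program for all stacks at once: a subprogram runs with a frame pushed
  on the stack and returns its value to that frame.\<close>

lemma reaches_ret_if_eval:
  "decode i = c \<Longrightarrow> eval q c x = Some y \<Longrightarrow> reaches q (run i x k) (ret y k)"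
proof (induction c arbitrary: i x y k)
  case (CPair f g)
  note i = decode_cases(6)[OF CPair.prems(1)]
  from CPair.prems(2) obtain a b where ab: "eval q f x = Some a" "eval q g x = Some b" "y = pair a b"
    by (auto split: option.splits)
  define d where "d = pair (psnd (psnd i)) x"
  have "reaches q (run (pfst (psnd i)) x (frame 0 d k)) (ret a (frame 0 d k))"
    using CPair.IH(1) i ab(1) by blast
  moreover have "reaches q (ret a (frame 0 d k)) (ret b (frame 4 a k))"
    by (rule reaches_step) (use CPair.IH(2) i ab(2) in \<open>simp add: ret_step_def Let_def d_def\<close>)
  moreover have "reaches q (ret b (frame 4 a k)) (ret y k)"
    by (rule reaches_step) (simp add: ret_step_def Let_def ab(3) reaches_refl)
  moreover have "step q (run i x k) = run (pfst (psnd i)) x (frame 0 d k)"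
    by (simp add: run_step_def Let_def d_def i)
  ultimately show ?case
    by (metis reaches_step reaches_trans)
next
  case (CComp f g)
  note i = decode_cases(7)[OF CComp.prems(1)]
  from CComp.prems(2) obtain z where z: "eval q g x = Some z" "eval q f z = Some y"
    by (auto simp: map_comp_def split: option.splits)
  define a where "a = pfst (psnd i)"
  have "reaches q (run (psnd (psnd i)) x (frame 1 a k)) (ret z (frame 1 a k))"
    using CComp.IH(2) i z(1) by blast
  moreover have "reaches q (ret z (frame 1 a k)) (ret y k)"
    by (rule reaches_step) (use CComp.IH(1) i z(2) in \<open>simp add: ret_step_def Let_def a_def\<close>)
  moreover have "step q (run i x k) = run (psnd (psnd i)) x (frame 1 a k)"
    by (simp add: run_step_def Let_def a_def i)
  ultimately show ?case
    by (metis reaches_step reaches_trans)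
next
  case (CPrec f g)
  note i = decode_cases(8)[OF CPrec.prems(1)]
  obtain u m where x: "x = pair u m"
    by (metis prod_decode_inverse surj_pair)
  define a b where "a = pfst (psnd i)" and "b = psnd (psnd i)"
  define R where "R = rec_nat (eval q f u)
    (\<lambda>j r. Option.bind r (\<lambda>z. eval q g (pair u (pair j z))))"
  define fr where "fr j = frame 2 (pair b (pair u (pair j m))) k" for j
  have Rm: "R m = Some y"
    using CPrec.prems(2) by (simp add: x R_def)
  \<comment> \<open>Loop invariant: after j rounds the intermediate value \<open>R j\<close> is
    returned to the frame with counter j. The frame is popped only when the counter is m.\<close>
  have "reaches q (run a u (fr 0)) (ret z (fr j))" if "j \<le> m" "R j = Some z" for j z
    using that
  proof (induction j arbitrary: z)
    case 0
    then show ?case using CPrec.IH(1) i by (simp add: R_def a_def)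
  next
    case (Suc j)
    from Suc.prems(2) obtain w where w: "R j = Some w" "eval q g (pair u (pair j w)) = Some z"
      by (auto simp: R_def bind_eq_Some_conv)
    have "reaches q (run b (pair u (pair j w)) (fr (Suc j))) (ret z (fr (Suc j)))"
      using CPrec.IH(2) i w(2) by (simp add: b_def)
    moreover have "step q (ret w (fr j)) = run b (pair u (pair j w)) (fr (Suc j))"
      using Suc.prems(1) by (simp add: fr_def ret_step_def Let_def)
    moreover have "reaches q (run a u (fr 0)) (ret w (fr j))"
      using Suc.IH Suc.prems(1) w(1) by simp
    ultimately show ?case
      by (metis reaches_step reaches_trans)
  qed
  from this[OF order_refl Rm] have "reaches q (run a u (fr 0)) (ret y (fr m))" .
  moreover have "step q (ret y (fr m)) = ret y k"
    by (simp add: fr_def ret_step_def Let_def)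
  moreover have "step q (run i x k) = run a u (fr 0)"
    by (simp add: run_step_def Let_def i x a_def b_def fr_def)
  ultimately show ?case
    by (metis reaches_refl reaches_step reaches_trans)
next
  case (CMu f)
  note i = decode_cases(9)[OF CMu.prems(1)]
  define a where "a = psnd i"
  define fr where "fr j = frame 3 (pair a (pair x j)) k" for j
  define P where "P m \<longleftrightarrow> eval q f (pair x m) = Some 0" for m
  from CMu.prems(2) obtain m where m: "P m" "\<forall>j<m. eval q f (pair x j) \<noteq> None"
      and y: "y = (LEAST m. P m)"
    by (auto simp: P_def split: if_splits)
  \<comment> \<open>The least zero y is at most m, so all earlier values are defined, and they are
    nonzero by minimality.\<close>
  have pos: "\<exists>z. eval q f (pair x j) = Some (Suc z)" if "j < y" for j
  proof -
    have "j < m" using that m(1) Least_le[of P m] by (simp add: y)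
    then obtain z where "eval q f (pair x j) = Some z"
      using m(2) by blast
    with not_less_Least[of j P] that show ?thesis
      by (cases z) (auto simp: P_def y)
  qed
  \<comment> \<open>The machine rejects the candidates below y one after the other.\<close>
  have start: "reaches q (run a (pair x 0) (fr 0)) (run a (pair x j) (fr j))" if "j \<le> y" for j
    using that
  proof (induction j)
    case 0
    show ?case by (rule reaches_refl)
  next
    case (Suc j)
    then obtain z where z: "eval q f (pair x j) = Some (Suc z)"
      using pos[of j] by auto
    have "reaches q (run a (pair x j) (fr j)) (ret (Suc z) (fr j))"
      using CMu.IH i z by (simp add: a_def)
    moreover have "step q (ret (Suc z) (fr j)) = run a (pair x (Suc j)) (fr (Suc j))"
      by (simp add: fr_def ret_step_def Let_def)
    moreover have "reaches q (run a (pair x 0) (fr 0)) (run a (pair x j) (fr j))"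
      using Suc by simp
    ultimately show ?case
      by (metis reaches_refl reaches_step reaches_trans)
  qed
  have "P y"
    using m(1) by (auto simp: y intro: LeastI)
  then have "reaches q (run a (pair x y) (fr y)) (ret 0 (fr y))"
    using CMu.IH i by (simp add: a_def P_def)
  moreover have "step q (ret 0 (fr y)) = ret y k"
    by (simp add: fr_def ret_step_def Let_def)
  moreover have "step q (run i x k) = run a (pair x 0) (fr 0)"
    using i by (simp add: run_step_def Let_def a_def fr_def)
  ultimately show ?case
    by (metis start[OF order_refl] reaches_refl reaches_step reaches_trans)
qed (simp_all add: reaches_if_step run_step_def decode_cases(1-5))

lemma funpow_step_ret_empty [simp]: "(step q ^^ n) (ret y 0) = ret y 0"
  by (induction n) simp_all

text \<open>The final state is a fixed point of \<^const>\<open>step\<close>, so it is unique.\<close>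

lemma funpow_step_run_iff:
  assumes "eval q (decode i) x = Some y"
  shows "(\<exists>n. (step q ^^ n) (run i x 0) = ret z 0) \<longleftrightarrow> y = z"
proof
  obtain m where m: "(step q ^^ m) (run i x 0) = ret y 0"
    using reaches_ret_if_eval[OF refl assms] unfolding reaches_def by blast
  show "\<exists>n. (step q ^^ n) (run i x 0) = ret z 0" if "y = z"
    using m that by blast
  assume "\<exists>n. (step q ^^ n) (run i x 0) = ret z 0"
  then obtain n where n: "(step q ^^ n) (run i x 0) = ret z 0" ..
  \<comment> \<open>After \<open>n + m\<close> steps both final states have been reached and
    kept.\<close>
  have "ret y 0 = (step q ^^ (n + m)) (run i x 0)"
    by (simp add: funpow_add m)
  also have "\<dots> = (step q ^^ (m + n)) (run i x 0)"
    by (simp add: add.commute)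
  also have "\<dots> = ret z 0"
    by (simp add: funpow_add n)
  finally show "y = z"
    by (simp add: ret_def)
qed

section \<open>The two reductions\<close>

lemma sW_reducibleI:
  assumes "is_problem f" "is_problem g" "total_computable k" "total_computable h"
    and "\<And>G. realizer G g \<Longrightarrow> realizer ((\<lambda>q. Some (h q)) \<circ>\<^sub>m G \<circ>\<^sub>m (\<lambda>p. Some (k p))) f"
  shows "f \<le>\<^sub>s\<^sub>W g"
  unfolding sW_reducible_def
proof (intro conjI exI allI impI)
  show "computable (\<lambda>q. Some (h q))" "computable (\<lambda>p. Some (k p))"
    by (intro computable_if_total_computable assms)+
qed (fact assms)+

lemma U_eq_Some_iff:
  "U \<phi> x = Some q \<longleftrightarrow>
     (\<forall>n. \<phi> (x 0) (bpair (\<lambda>n. bfst x (Suc n)) (bsnd x)) n = Some (q n))"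
proof -
  have "(if \<forall>n. f n \<noteq> None then Some (\<lambda>n. the (f n)) else None) = Some q \<longleftrightarrow>
      (\<forall>n. f n = Some (q n))" for f :: "nat \<rightharpoonup> nat"
  proof (cases "\<exists>n. f n = None")
    case True
    then obtain n where "f n = None" ..
    then have "\<not> (\<forall>n. f n \<noteq> None)" "f n \<noteq> Some (q n)"
      by auto
    then show ?thesis by auto
  next
    case False
    define g where "g n = the (f n)" for n
    have "f = (\<lambda>n. Some (g n))"
      using False by (auto simp: g_def)
    then show ?thesis by (simp add: fun_eq_iff)
  qed
  then show ?thesis
    by (simp add: U_def Let_def bfst_def)
qed

lemma NRNG_realizerE:
  assumes "realizer G NRNG"
  obtains A where "G p = Some A" "A \<in> cantor" "A \<noteq> indicator (range_minus_one p)"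
proof -
  \<comment> \<open>The complement of the range is a solution, so \<open>G\<close> must be defined
    on every instance.\<close>
  have "indicator (- range_minus_one p) \<in> sols NRNG p"
    by (auto simp: NRNG_def cantor_def indicator_def fun_eq_iff)
  moreover have "source NRNG p = Some p"
    by (simp add: NRNG_def)
  ultimately obtain q A where "G p = Some q" "target NRNG q = Some A" "A \<in> sols NRNG p"
    using assms unfolding realizer_def by (metis empty_iff)
  then show ?thesis
    by (intro that[of A]) (simp_all add: NRNG_def restrict_map_def split: if_splits)
qed

lemma DIS_le_NRNG:
  assumes "standard_numbering \<phi>"
  shows "DIS \<phi> \<le>\<^sub>s\<^sub>W NRNG"
proof -
  obtain s where s: "computable_nat s" and \<phi>: "\<phi> i = kleene_numbering (s i)" for i
    using assms unfolding standard_numbering_def by blast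
  define Q where "Q x = bpair (\<lambda>n. bfst x (Suc n)) (bsnd x)" for x
  \<comment> \<open>At stage z, coding a pair of k and n, k is enumerated (as k + 1) if the program
    returns 1 on k after n steps; otherwise 0 marks an empty entry.\<close>
  define K where "K x z =
    (if (step (Q x) ^^ psnd z) (run (s (x 0)) (pfst z) 0) = ret 1 0 then Suc (pfst z) else 0)" for x z
  \<comment> \<open>Dropping the index shifts the even positions of x by two and keeps the odd
    ones.\<close>
  have "Q = (\<lambda>x n. if even n then x (Suc (Suc n)) else x n)"
    by (auto simp: Q_def bpair_def bfst_def bsnd_def fun_eq_iff)
  then have Q: "total_computable Q"
    by (simp only:) (intro total_computable_intros)
  have "total_computable (\<lambda>p n. s n)"
    using s unfolding computable_nat_def total_computable_def .
  from total_computable_comp[OF this total_computable_oracle[OF total_computable_const]]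
  have "total_computable (\<lambda>p n. s (p 0))" .
  then have "total_computable K"
    unfolding K_def[abs_def]
    by (intro total_computable_intros total_computable_funpow total_computable_step Q)
  moreover have "total_computable (\<lambda>p n. p n)"
    by (intro total_computable_intros)
  moreover have "realizer (Some \<circ>\<^sub>m G \<circ>\<^sub>m (\<lambda>x. Some (K x))) (DIS \<phi>)" if "realizer G NRNG" for G
  proof -
    have "\<exists>A. G (K x) = Some A \<and> U \<phi> x \<noteq> Some A" for x
    proof -
      obtain A where A: "G (K x) = Some A" "A \<in> cantor" "A \<noteq> indicator (range_minus_one (K x))"
        using \<open>realizer G NRNG\<close> by (rule NRNG_realizerE)
      have "A = indicator (range_minus_one (K x))" if "U \<phi> x = Some A"
      proof
        fix k
        have "eval (Q x) (decode (s (x 0))) k = Some (A k)"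
          using that by (simp add: U_eq_Some_iff Q_def \<phi> kleene_numbering_def)
        \<comment> \<open>The run on k ends in the single value \<open>A k\<close>, so k is
          enumerated iff this value is 1.\<close>
        from funpow_step_run_iff[OF this, of 1] have "k \<in> range_minus_one (K x) \<longleftrightarrow> A k = 1"
          unfolding range_minus_one_def K_def
          by (auto split: if_splits) (metis prod_encode_inverse fst_conv snd_conv)
        moreover have "A k \<in> {0, 1}"
          using A(2) by (simp add: cantor_def)
        ultimately show "A k = indicator (range_minus_one (K x)) k"
          by (auto simp: indicator_def)
      qed
      with A show ?thesis by blast
    qed
    then obtain A where "G (K x) = Some (A x) \<and> U \<phi> x \<noteq> Some (A x)" for x
      by metis
    then show ?thesis
      by (simp add: realizer_def DIS_def map_comp_def)
  qed
  ultimately show ?thesis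
    by (rule sW_reducibleI[where h = "\<lambda>q. q" and k = K, OF is_problem_DIS is_problem_NRNG])
qed

section \<open>Reduction of NRNG to DIS\<close>

definition graph_chi :: "baire \<Rightarrow> baire" where
  "graph_chi q z = (if q (pfst z) = psnd z then 1 else 0)"

text \<open>The oracle is \<open>bpair r p\<close> for an enumeration \<open>p\<close> of a graph, so \<open>p j\<close> is found at
  position \<open>Suc (2 * j)\<close>.\<close>

lemma ex_graph_search:
  "\<exists>c. \<forall>r p q. range_minus_one p = {z. q (pfst z) = psnd z} \<longrightarrow>
     (\<forall>n. eval (bpair r p) c n = Some (q n))"
proof -
  \<comment> \<open>Zero signals success, as \<open>CMu\<close> looks for a zero: entry j must be
    nonempty and have first component n.\<close>
  define test where "test w z =
    (let e = w (Suc (2 * psnd z)) in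
     if e = 0 then 1 else if pfst (e - 1) = pfst z then 0 else 1 :: nat)"
    for w :: baire and z
  define val where "val w j = psnd (w (Suc (2 * j)) - 1)" for w :: baire and j :: nat
  have "total_computable test"
    unfolding test_def[abs_def] Let_def by (intro total_computable_intros)
  then obtain c where c: "eval p c n = Some (test p n)" for p n
    unfolding total_computable_def by blast
  have "total_computable val"
    unfolding val_def[abs_def] by (intro total_computable_intros)
  then obtain d where d: "eval p d n = Some (val p n)" for p n
    unfolding total_computable_def by blast
  have "eval (bpair r p) (CComp d (CMu c)) n = Some (q n)"
    if graph: "range_minus_one p = {z. q (pfst z) = psnd z}" for r p q n
  proof -
    have test: "test (bpair r p) (pair n j) = 0 \<longleftrightarrow> p j \<noteq> 0 \<and> pfst (p j - 1) = n" for j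
      by (simp add: test_def bpair_def Let_def)
    have val: "val (bpair r p) j = psnd (p j - 1)" for j
      by (simp add: val_def bpair_def)
    \<comment> \<open>As q is total, some pair in its graph has first component n, so the search
      ends.\<close>
    have "pair n (q n) \<in> range_minus_one p"
      by (simp add: graph)
    then obtain j where "p j = pair n (q n) + 1"
      unfolding range_minus_one_def by blast
    then have ex: "test (bpair r p) (pair n j) = 0"
      by (simp add: test)
    define m where "m = (LEAST m. test (bpair r p) (pair n m) = 0)"
    have "test (bpair r p) (pair n m) = 0"
      unfolding m_def using ex by (rule LeastI)
    then have pm: "p m \<noteq> 0" "pfst (p m - 1) = n"
      by (simp_all add: test)
    \<comment> \<open>The entry found lies in the graph of q and has first component n, so its
      second component is \<open>q n\<close>.\<close>
    have "p m = (p m - 1) + 1"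
      using pm(1) by simp
    then have "p m - 1 \<in> range_minus_one p"
      unfolding range_minus_one_def by blast
    then have "q (pfst (p m - 1)) = psnd (p m - 1)"
      unfolding graph by (rule CollectD)
    then have "val (bpair r p) m = q n"
      by (simp only: val pm(2))
    moreover have "eval (bpair r p) (CMu c) n = Some m"
      unfolding m_def eval.simps(9) c option.inject using ex by (metis (mono_tags) option.distinct(1))
    ultimately show ?thesis
      by (simp add: d map_comp_def del: eval.simps(9))
  qed
  then show ?thesis by (intro exI[of _ "CComp d (CMu c)"]) simp
qed

lemma NRNG_le_DIS:
  assumes "standard_numbering \<phi>"
  shows "NRNG \<le>\<^sub>s\<^sub>W DIS \<phi>"
proof -
  obtain t where t: "kleene_numbering i = \<phi> (t i)" for i
    using assms unfolding standard_numbering_def by blast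
  obtain c where c: "range_minus_one p = {z. q (pfst z) = psnd z} \<Longrightarrow>
      eval (bpair r p) c n = Some (q n)" for r p q n
    using ex_graph_search by blast
  obtain i where i: "decode i = c"
    using surj_decode by (metis surjD)
  \<comment> \<open>One index of the search serves all instances: p is supplied as oracle, and the
    parameter r is filled with zeros.\<close>
  define K where "K p = bpair (bcons (t i) (\<lambda>_. 0)) p" for p
  have "bcons (t i) (\<lambda>_. 0) n = (if n = 0 then t i else 0)" for n
    by (cases n) (auto simp: bcons_def)
  then have "total_computable K"
    unfolding K_def[abs_def] bpair_def by (simp only:) (intro total_computable_intros)
  moreover have "total_computable graph_chi"
    unfolding graph_chi_def[abs_def] by (intro total_computable_intros)
  moreover have "realizer ((\<lambda>q. Some (graph_chi q)) \<circ>\<^sub>m G \<circ>\<^sub>m (\<lambda>p. Some (K p))) NRNG"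
    if G: "realizer G (DIS \<phi>)" for G
  proof -
    have "\<exists>q. G (K p) = Some q \<and> graph_chi q \<in> cantor \<and>
        graph_chi q \<noteq> indicator (range_minus_one p)" for p
    proof -
      \<comment> \<open>Two distinct functions cannot both equal \<open>U \<phi> (K p)\<close>, so
        \<open>DIS\<close> has a solution there.\<close>
      have "(\<lambda>_. 0 :: nat) \<noteq> (\<lambda>_ :: nat. 1)"
        by (simp add: fun_eq_iff)
      then have "sols (DIS \<phi>) (K p) \<noteq> {}"
        by (auto simp: DIS_def) (metis option.inject)
      then obtain q where q: "G (K p) = Some q" "U \<phi> (K p) \<noteq> Some q"
        using G unfolding realizer_def by (fastforce simp: DIS_def)
      \<comment> \<open>Otherwise p enumerates the graph of q and the search computes q, against the
        choice of q.\<close>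
      have "U \<phi> (K p) = Some q" if "graph_chi q = indicator (range_minus_one p)"
      proof -
        have "q (pfst z) = psnd z \<longleftrightarrow> z \<in> range_minus_one p" for z
          using fun_cong[OF that, of z]
          by (cases "z \<in> range_minus_one p") (simp_all add: graph_chi_def split: if_splits)
        then have "range_minus_one p = {z. q (pfst z) = psnd z}"
          by blast
        from c[OF this] have "\<phi> (t i) (bpair (\<lambda>_. 0) p) n = Some (q n)" for n
          by (simp add: kleene_numbering_def i flip: t)
        then show ?thesis
          by (simp add: K_def U_bpair)
      qed
      with q show ?thesis
        by (auto simp: cantor_def graph_chi_def)
    qed
    then obtain q where "G (K p) = Some (q p) \<and> graph_chi (q p) \<in> cantor \<and>
        graph_chi (q p) \<noteq> indicator (range_minus_one p)" for p
      by metis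
    then show ?thesis
      by (simp add: realizer_def NRNG_def map_comp_def)
  qed
  ultimately show ?thesis
    by (rule sW_reducibleI[where h = graph_chi and k = K, OF is_problem_NRNG is_problem_DIS])
qed

theorem proposition1p13:
  fixes \<phi> :: numbering
  assumes "standard_numbering \<phi>"
  shows "DIS \<phi> \<equiv>\<^sub>s\<^sub>W NRNG"
  using assms DIS_le_NRNG NRNG_le_DIS by (simp add: sW_equivalent_def)

end
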